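(* Let $W^*_2$ be the smallest constant $W>0$ such that $$\|f\| \le W\,\omega_2(f,h)$$ for every $h>0$ and every locally integrable function $f:\mathbb{R}\to\mathbb{R}$ satisfying $\int_{jh}^{(j+1)h} f(u)\,du=0$ for all $j\in\mathbb{Z}$. Then $$\frac12+\frac{3}{37} \le W^*_2 \le \frac12+\frac18 .$$
   Context: Functions are defined at every point of $\mathbb{R}$ and are not identified when they agree almost everywhere. The norm is the pointwise supremum $\|f\| := \sup_{x\in\mathbb{R}} |f(x)|$ (not an essential supremum). For $t\in\mathbb{R}$ the symmetric second difference is $$\Delta_t^2 f(x) := f(x-t)-2f(x)+f(x+t),$$ and the second modulus of smoothness is $$\omega_2(f,h) := \sup_{|t|\le h} \|\Delta_t^2 f(\cdot)\| \in [0,\infty].$$ If $\omega_2(f,h)=\infty$, the inequality $\|f\|\le W\,\omega_2(f,h)$ is regarded as trivially satisfied. *)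

theory Defs
  imports "HOL-Analysis.Analysis"
begin

text \<open>The supremum is pointwise, not essential, and takes values in \<open>[0,\<infinity>]\<close>.\<close>

definition sup_norm :: "(real \<Rightarrow> real) \<Rightarrow> ennreal" where
  "sup_norm f = (SUP x. ennreal \<bar>f x\<bar>)"

definition second_difference :: "real \<Rightarrow> (real \<Rightarrow> real) \<Rightarrow> real \<Rightarrow> real" where
  "second_difference t f x = f (x - t) - 2 * f x + f (x + t)"

definition omega2 :: "(real \<Rightarrow> real) \<Rightarrow> real \<Rightarrow> ennreal" where
  "omega2 f h = (SUP t\<in>{t. \<bar>t\<bar> \<le> h}. sup_norm (second_difference t f))"

definition locally_integrable :: "(real \<Rightarrow> real) \<Rightarrow> bool" where
  "locally_integrable f \<longleftrightarrow> (\<forall>K. compact K \<longrightarrow> set_integrable lebesgue K f)"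

text \<open>
  The inequality below is one in \<open>[0,\<infinity>]\<close>. As \<open>W\<close> is positive, it holds trivially when
  \<open>omega2 f h = \<infinity>\<close>; when \<open>omega2 f h\<close> is finite it asserts in particular that
  \<open>f\<close> is bounded.
\<close>

definition is_whitney_constant :: "real \<Rightarrow> bool" where
  "is_whitney_constant W \<longleftrightarrow> W > 0 \<and>
     (\<forall>h>0. \<forall>f. locally_integrable f \<longrightarrow>
        (\<forall>j::int. (LINT u:{of_int j * h..(of_int j + 1) * h}|lebesgue. f u) = 0) \<longrightarrow>
        sup_norm f \<le> ennreal W * omega2 f h)"

definition W2_star :: real where
  "W2_star = (LEAST W. is_whitney_constant W)"

end

theory Submission
  imports Defs
begin

text \<open>For the upper bound let \<open>h = 1\<close>, \<open>0 \<le> x \<le> 1 / 2\<close> (the rest follows by translation and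
  reflection), let \<open>w\<close> be the modulus and let \<open>R\<close> be the integral of \<open>f\<close> over \<open>[2 * x - 1, 0]\<close>.
  Averaging the second differences of \<open>f\<close> at \<open>x\<close> over the steps in \<open>[0, 1 - x]\<close> gives
  \<open>\<bar>R / (1 - x) - 2 * f x\<bar> \<le> w\<close>. Averaging along the segment on which the step \<open>\<tau>\<close> runs from \<open>0\<close>
  to \<open>1\<close> while the centre runs from \<open>2 * x - 1\<close> to \<open>0\<close>, the three nodes sweep \<open>[-1, 2 * x - 1]\<close>,
  \<open>[2 * x - 1, 0]\<close> and \<open>[2 * x - 1, 1]\<close>, over which \<open>f\<close> has integrals \<open>-R\<close>, \<open>R\<close> and \<open>R\<close>; this
  yields \<open>\<bar>R\<bar> / (1 - x) \<le> w / 4\<close>, by \<open>(4 * x - 1)\<^sup>2 \<ge> 0\<close>. The lower bound comes from a step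
  function with value \<open>14\<close> at \<open>1 / 4\<close> and modulus at most \<open>24\<close>, and \<open>14 / 24 > 1 / 2 + 3 / 37\<close>.\<close>

section \<open>Extended-real inequalities as pointwise real bounds\<close>

lemma sup_norm_le_iff:
  assumes "0 \<le> C"
  shows "sup_norm f \<le> ennreal C \<longleftrightarrow> (\<forall>x. \<bar>f x\<bar> \<le> C)"
  using assms by (simp add: sup_norm_def SUP_le_iff)

lemma omega2_le_iff:
  assumes "0 \<le> w"
  shows "omega2 f h \<le> ennreal w \<longleftrightarrow> (\<forall>t x. \<bar>t\<bar> \<le> h \<longrightarrow> \<bar>second_difference t f x\<bar> \<le> w)"
  using assms by (auto simp: omega2_def SUP_le_iff sup_norm_le_iff)

lemma whitney_inequality_iff:
  assumes "W > 0" "omega2 f h = ennreal w" "w \<ge> 0"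
  shows "sup_norm f \<le> ennreal W * omega2 f h \<longleftrightarrow> (\<forall>x. \<bar>f x\<bar> \<le> W * w)"
  using assms sup_norm_le_iff[of "W * w" f] by (simp add: ennreal_mult)

section \<open>The upper bound\<close>

lemma has_integral_affine_substitution:
  fixes f :: "real \<Rightarrow> real"
  assumes "(f has_integral I) {p..q}" "p \<le> q" "0 < e"
  shows "((\<lambda>s. f (c + e * s)) has_integral I / e) {(p - c) / e..(q - c) / e}"
    and "((\<lambda>s. f (c - e * s)) has_integral I / e) {(c - q) / e..(c - p) / e}"
proof -
  have im1: "(\<lambda>x. (1 / e) *\<^sub>R x + - ((1 / e) *\<^sub>R c)) ` cbox p q = {(p - c) / e..(q - c) / e}"
    using assms image_affinity_cbox[of "1 / e" "- ((1 / e) *\<^sub>R c)" p q]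
    by (auto simp: field_simps)
  have im2: "(\<lambda>x. (1 / - e) *\<^sub>R x + - ((1 / - e) *\<^sub>R c)) ` cbox p q = {(c - q) / e..(c - p) / e}"
    using assms image_affinity_cbox[of "1 / - e" "- ((1 / - e) *\<^sub>R c)" p q]
    by (auto simp: field_simps)
  show "((\<lambda>s. f (c + e * s)) has_integral I / e) {(p - c) / e..(q - c) / e}"
    using has_integral_affinity[of f I p q e c] assms im1
    by (simp add: add.commute field_simps)
  show "((\<lambda>s. f (c - e * s)) has_integral I / e) {(c - q) / e..(c - p) / e}"
    using has_integral_affinity[of f I p q "- e" c] assms im2
    by (simp add: add.commute field_simps)
qed

text \<open>Puts each node of a second difference on the common parameter interval from 0 to 1, so
  that the three averages can be added; the sign is the direction of the sweep.\<close>

lemma has_integral_rescale: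
  fixes f :: "real \<Rightarrow> real"
  assumes "(f has_integral I) {p..q}" "p < q"
  shows "((\<lambda>\<tau>. f (p + (q - p) * \<tau>)) has_integral I / (q - p)) {0..1}"
    and "((\<lambda>\<tau>. f (q - (q - p) * \<tau>)) has_integral I / (q - p)) {0..1}"
  using has_integral_affine_substitution(1)[of f I p q "q - p" p]
    has_integral_affine_substitution(2)[of f I p q "q - p" q] assms
  by simp_all

lemma abs_has_integral_unit_interval_le:
  fixes f :: "real \<Rightarrow> real"
  assumes "(f has_integral I) {0..1}" "\<And>\<tau>. \<tau> \<in> {0..1} \<Longrightarrow> \<bar>f \<tau>\<bar> \<le> w"
  shows "\<bar>I\<bar> \<le> w"
proof -
  have "0 \<le> w"
    using assms(2)[of 0] abs_ge_zero[of "f 0"] by simp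
  then show ?thesis
    using has_integral_bound[of w f I 0 1] assms by simp
qed

lemma abs_le_five_eighths:
  fixes g :: "real \<Rightarrow> real"
  assumes int: "g integrable_on {-1..1}"
    and zero: "integral {-1..0} g = 0" "integral {0..1} g = 0"
    and bound: "\<And>x t. \<bar>t\<bar> \<le> 1 \<Longrightarrow> \<bar>second_difference t g x\<bar> \<le> w"
    and x: "0 \<le> x" "x \<le> 1 / 2"
  shows "\<bar>g x\<bar> \<le> 5 / 8 * w"
proof -
  have w: "0 \<le> w"
    using bound[of 0 0] by simp
  have sub: "g integrable_on {a..b}" if "-1 \<le> a" "b \<le> 1" for a b
    using int that integrable_on_subinterval[of g "{-1..1}" a b] by auto
  have comb: "integral {a..b} g + integral {b..c} g = integral {a..c} g"
    if "-1 \<le> a" "a \<le> b" "b \<le> c" "c \<le> 1" for a b c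
    using that by (intro Henstock_Kurzweil_Integration.integral_combine sub) auto
  define R where "R = integral {2 * x - 1..0} g"
  have R_left: "integral {-1..2 * x - 1} g = - R"
    using comb[of "-1" "2 * x - 1" 0] zero x by (simp add: R_def)
  have R_right: "integral {2 * x - 1..1} g = R"
    using comb[of "2 * x - 1" 0 1] zero x by (simp add: R_def)
  have center: "\<bar>R / (1 - x) - 2 * g x\<bar> \<le> w"
  proof -
    define L where "L = integral {2 * x - 1..x} g"
    define M where "M = integral {x..1} g"
    have LM: "L + M = R"
      using comb[of "2 * x - 1" x 1] x R_right by (simp add: L_def M_def)
    have l: "((\<lambda>\<tau>. g (x - (1 - x) * \<tau>)) has_integral L / (1 - x)) {0..1}"
      using has_integral_rescale(2)[of g L "2 * x - 1" x] x sub[of "2 * x - 1" x]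
      by (simp add: L_def has_integral_integral)
    have r: "((\<lambda>\<tau>. g (x + (1 - x) * \<tau>)) has_integral M / (1 - x)) {0..1}"
      using has_integral_rescale(1)[of g M x 1] x sub[of x 1]
      by (simp add: M_def has_integral_integral)
    have "((\<lambda>\<tau>. second_difference ((1 - x) * \<tau>) g x) has_integral
        L / (1 - x) - 2 * g x + M / (1 - x)) {0..1}"
      unfolding second_difference_def
      using has_integral_add[OF has_integral_diff[OF l has_integral_const_real[of "2 * g x" 0 1]] r]
      by simp
    moreover have "\<bar>second_difference ((1 - x) * \<tau>) g x\<bar> \<le> w" if "\<tau> \<in> {0..1}" for \<tau>
      using that x bound[of "(1 - x) * \<tau>" x] mult_mono[of "1 - x" 1 \<tau> 1] by (simp add: abs_mult)
    ultimately have "\<bar>L / (1 - x) - 2 * g x + M / (1 - x)\<bar> \<le> w"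
      by (rule abs_has_integral_unit_interval_le)
    then show ?thesis
      unfolding LM[symmetric] add_divide_distrib by (simp only: diff_add_eq)
  qed
  have "\<bar>R\<bar> / (1 - x) \<le> w / 4"
  \<comment> \<open>At these two points a divisor \<open>2 * x\<close> or \<open>1 - 2 * x\<close>
    below vanishes, but there \<open>R\<close> is an integral over a full cell or over a point,
    hence 0.\<close>
  proof (cases "x = 0 \<or> x = 1 / 2")
    case True
    then have "2 * x - 1 = -1 \<or> 2 * x - 1 = 0"
      by auto
    moreover have "integral {0..0} g = 0"
      by simp
    ultimately have "R = 0"
      using zero unfolding R_def by metis
    then show ?thesis
      using w by simp
  next
    case False
    then have x': "0 < x" "x < 1 / 2"
      using x by auto
    \<comment> \<open>The centre moves with speed \<open>1 - 2 * x\<close>; subtracting or adding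
      the step gives the outer nodes speeds \<open>- 2 * x\<close> and \<open>2 - 2 * x\<close>. The
      absolute speeds are the divisors.\<close>
    have l: "((\<lambda>\<tau>. g (2 * x - 1 - 2 * x * \<tau>)) has_integral - R / (2 * x)) {0..1}"
      using has_integral_rescale(2)[of g "- R" "-1" "2 * x - 1"] x' sub[of "-1" "2 * x - 1"] R_left
      by (simp add: has_integral_iff)
    have c: "((\<lambda>\<tau>. g (2 * x - 1 + (1 - 2 * x) * \<tau>)) has_integral R / (1 - 2 * x)) {0..1}"
      using has_integral_rescale(1)[of g R "2 * x - 1" 0] x' sub[of "2 * x - 1" 0]
      by (simp add: R_def has_integral_integral)
    have r: "((\<lambda>\<tau>. g (2 * x - 1 + (2 - 2 * x) * \<tau>)) has_integral R / (2 - 2 * x)) {0..1}"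
      using has_integral_rescale(1)[of g R "2 * x - 1" 1] x' sub[of "2 * x - 1" 1] R_right
      by (simp add: has_integral_iff)
    have "((\<lambda>\<tau>. second_difference \<tau> g (2 * x - 1 + (1 - 2 * x) * \<tau>)) has_integral
        - R / (2 * x) - 2 * (R / (1 - 2 * x)) + R / (2 - 2 * x)) {0..1}"
      using has_integral_add[OF has_integral_diff[OF l has_integral_mult_right[OF c, of 2]] r]
      by (simp add: second_difference_def algebra_simps)
    moreover have "\<bar>second_difference \<tau> g (2 * x - 1 + (1 - 2 * x) * \<tau>)\<bar> \<le> w"
      if "\<tau> \<in> {0..1}" for \<tau>
      using that bound[of \<tau>] by simp
    ultimately have R_le: "\<bar>- R / (2 * x) - 2 * (R / (1 - 2 * x)) + R / (2 - 2 * x)\<bar> \<le> w"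
      by (rule abs_has_integral_unit_interval_le)
    define K where "K = 1 / (2 * x) + 2 / (1 - 2 * x) - 1 / (2 - 2 * x)"
    \<comment> \<open>Equality \<open>K = 4 / (1 - x)\<close> holds at \<open>x = 1 / 4\<close>, so
      4 is the best constant here.\<close>
    have "K - 4 / (1 - x) = (4 * x - 1)\<^sup>2 / (2 * x * (1 - 2 * x) * (1 - x))"
      using x' unfolding K_def by (simp add: divide_simps) (simp add: algebra_simps power2_eq_square)
    also have "\<dots> \<ge> 0"
      using x' by simp
    finally have K: "4 / (1 - x) \<le> K"
      by simp
    have "- R / (2 * x) - 2 * (R / (1 - 2 * x)) + R / (2 - 2 * x) = - (R * K)"
      by (simp add: K_def algebra_simps)
    moreover have "0 \<le> K"
      using K x' order_trans[of 0 "4 / (1 - x)" K] by simp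
    ultimately have "\<bar>R\<bar> * K \<le> w"
      using R_le by (simp add: abs_mult)
    moreover have "\<bar>R\<bar> * (4 / (1 - x)) \<le> \<bar>R\<bar> * K"
      using K by (intro mult_left_mono) auto
    ultimately show ?thesis
      by simp
  qed
  moreover have "\<bar>R / (1 - x)\<bar> = \<bar>R\<bar> / (1 - x)"
    using x by simp
  \<comment> \<open>By the triangle inequality, \<open>2 * \<bar>g x\<bar>\<close> is at most
    \<open>w + w / 4\<close>.\<close>
  ultimately show ?thesis
    using center by linarith
qed

lemma is_whitney_constant_five_eighths: "is_whitney_constant (5 / 8)"
  unfolding is_whitney_constant_def
proof (intro conjI allI impI)
  fix h :: real and f :: "real \<Rightarrow> real"
  assume h: "0 < h" and f: "locally_integrable f"
    and zero: "\<forall>j::int. (LINT u:{of_int j * h..(of_int j + 1) * h}|lebesgue. f u) = 0"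
  show "sup_norm f \<le> ennreal (5 / 8) * omega2 f h"
  proof (cases "omega2 f h" rule: ennreal_cases)
    case top
    then show ?thesis
      by (simp add: ennreal_mult_top)
  next
    case (real w)
    then have bound: "\<bar>second_difference t f x\<bar> \<le> w" if "\<bar>t\<bar> \<le> h" for t x
      using that omega2_le_iff[of w f h] by simp
    have hi: "(f has_integral 0) {of_int j * h..(of_int j + 1) * h}" for j :: int
    proof -
      have "set_integrable lebesgue {of_int j * h..(of_int j + 1) * h} f"
        using f by (simp add: locally_integrable_def)
      from set_lebesgue_integral_eq_integral[OF this] show ?thesis
        using zero by (simp add: has_integral_iff)
    qed
    have "\<bar>f y\<bar> \<le> 5 / 8 * w" for y
    proof -
      define j where "j = \<lfloor>y / h\<rfloor>"
      define u where "u = y / h - j"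
      have u: "0 \<le> u" "u < 1"
        unfolding u_def j_def by linarith+
      have y: "y = h * j + h * u"
        using h by (simp add: u_def field_simps)
      \<comment> \<open>The origin \<open>c\<close> will be an end point of the cell of
        \<open>y\<close> closest to \<open>y\<close>. Taking \<open>e = h\<close> translates the
        left half of the cell, and \<open>e = - h\<close> reflects the right half; either way unit
        steps become steps of length at most \<open>h\<close>.\<close>
      have core: "\<bar>f (c + e * x)\<bar> \<le> 5 / 8 * w"
        if x: "0 \<le> x" "x \<le> 1 / 2" and e: "\<bar>e\<bar> = h"
          and zero: "((\<lambda>s. f (c + e * s)) has_integral 0) {-1..0}"
            "((\<lambda>s. f (c + e * s)) has_integral 0) {0..1}"
        for c e x
      proof (rule abs_le_five_eighths[OF _ _ _ _ x])
        show "integral {-1..0} (\<lambda>s. f (c + e * s)) = 0" "integral {0..1} (\<lambda>s. f (c + e * s)) = 0"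
          using zero by (auto simp: has_integral_iff)
        show "(\<lambda>s. f (c + e * s)) integrable_on {-1..1}"
          using has_integral_combine[OF _ _ zero] by (auto simp: has_integral_iff)
        show "\<bar>second_difference t (\<lambda>s. f (c + e * s)) x\<bar> \<le> w" if "\<bar>t\<bar> \<le> 1" for x t
          using bound[of "e * t" "c + e * x"] that e h
          by (simp add: second_difference_def abs_mult algebra_simps)
      qed
      show ?thesis
      proof (cases "u \<le> 1 / 2")
        case True
        have "((\<lambda>s. f (h * j + h * s)) has_integral 0) {-1..0}"
          using has_integral_affine_substitution(1)[OF hi[of "j - 1"], of h "h * j"] h
          by (simp add: field_simps)
        moreover have "((\<lambda>s. f (h * j + h * s)) has_integral 0) {0..1}"
          using has_integral_affine_substitution(1)[OF hi[of j], of h "h * j"] h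
          by (simp add: field_simps)
        ultimately show ?thesis
          using core[of u h "h * j"] True u y h by simp
      next
        case False
        have "((\<lambda>s. f (h * (j + 1) - h * s)) has_integral 0) {-1..0}"
          using has_integral_affine_substitution(2)[OF hi[of "j + 1"], of h "h * (j + 1)"] h
          by (simp add: field_simps)
        moreover have "((\<lambda>s. f (h * (j + 1) - h * s)) has_integral 0) {0..1}"
          using has_integral_affine_substitution(2)[OF hi[of j], of h "h * (j + 1)"] h
          by (simp add: field_simps)
        moreover have "y = h * (j + 1) - h * (1 - u)"
          using y by (simp add: algebra_simps)
        ultimately show ?thesis
          using core[of "1 - u" "- h" "h * (j + 1)"] False u h by simp
      qed
    qed
    then show ?thesis
      using real whitney_inequality_iff[of "5 / 8" f h w] by simp
  qed
qed simp

section \<open>The lower bound\<close>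

text \<open>The number \<open>\<lfloor>4 * x\<rfloor> + \<lceil>4 * x\<rceil>\<close> is \<open>2 * k\<close> at the grid point \<open>x = k / 4\<close> and
  \<open>2 * k + 1\<close> on the open cell between \<open>k / 4\<close> and \<open>(k + 1) / 4\<close>. The values below come from
  rounding the solution of the linear program that maximises \<open>f (1 / 4)\<close> over the functions that
  depend only on this number and vanish outside \<open>[-1, 2]\<close>.\<close>

definition cell :: "real \<Rightarrow> int" where
  "cell x = \<lfloor>4 * x\<rfloor> + \<lceil>4 * x\<rceil>"

text \<open>The indices run from the open cell between -1 and -3/4 to the one between 7/4 and 2.
  Even indices are single points, invisible to the integrals but not to the pointwise norm; the
  value 14 sits at such a point.\<close>

definition cell_value :: "int \<Rightarrow> int" where
  "cell_value k =
    (if k < -7 \<or> 15 < k then 0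
     else [-8, 4, -5, 4, 8, 4, 5, 4, 4, 14, 0, 0, 0, 0, -4, 0, 9, 0, -2, 0, -2, 0, -5] ! nat (k + 7))"

definition step_example :: "real \<Rightarrow> real" where
  "step_example x = cell_value (cell x)"

lemma cell_of_int: "4 * x = of_int k \<Longrightarrow> cell x = 2 * k"
  by (simp add: cell_def)

lemma cell_between: "of_int k < 4 * x \<Longrightarrow> 4 * x < of_int k + 1 \<Longrightarrow> cell x = 2 * k + 1"
  using floor_unique[of k "4 * x"] ceiling_unique[of "k + 1" "4 * x"] by (simp add: cell_def)

lemma mono_cell: "x \<le> y \<Longrightarrow> cell x \<le> cell y"
  unfolding cell_def by (intro add_mono floor_mono ceiling_mono) auto

text \<open>A unit shift adds 4 to both the floor and the ceiling. This makes the later check of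
  offsets finite.\<close>

lemma cell_le_cell_add_8: "y \<le> x + 1 \<Longrightarrow> cell y \<le> cell x + 8"
  using mono_cell[of y "x + 1"] by (simp add: cell_def distrib_left)

text \<open>The nodes are in arithmetic progression. Around a grid point reflection exchanges floor
  and ceiling, so the offsets of the numbers agree exactly; otherwise rounding makes them differ by
  at most 2.\<close>

lemma cell_progression:
  obtains (grid) k where "cell x = 2 * k" "cell (x - t) + cell (x + t) = 4 * k"
  | (between) k where "cell x = 2 * k + 1" "\<bar>cell (x - t) + cell (x + t) - (4 * k + 2)\<bar> \<le> 2"
proof (cases "4 * x = of_int \<lfloor>4 * x\<rfloor>")
  case True
  define k where "k = \<lfloor>4 * x\<rfloor>"
  have "4 * (x - t) = of_int k - 4 * t" "4 * (x + t) = of_int k + 4 * t"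
    using True by (simp_all add: k_def algebra_simps)
  then have "cell (x - t) + cell (x + t) = 4 * k"
    by (simp add: cell_def ceiling_def) linarith
  then show ?thesis
    using grid[of k] cell_of_int[of x k] True by (simp add: k_def)
next
  case False
  define k where "k = \<lfloor>4 * x\<rfloor>"
  have k: "of_int k < 4 * x" "4 * x < of_int k + 1"
    using False of_int_floor_le[of "4 * x"] floor_correct[of "4 * x"]
    by (auto simp: k_def simp del: of_int_floor_le)
  \<comment> \<open>The two rounding errors have opposite signs, so the sum is within less than 1 of
    \<open>8 * x\<close>, which lies strictly between \<open>2 * k\<close> and
    \<open>2 * k + 2\<close>. Both orders of the outer nodes are used below.\<close>
  have between_sum: "2 * k \<le> \<lfloor>a\<rfloor> + \<lceil>b\<rceil> \<and> \<lfloor>a\<rfloor> + \<lceil>b\<rceil> \<le> 2 * k + 2" if "a + b = 8 * x" for a b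
  proof -
    have "of_int (2 * k) < (of_int (\<lfloor>a\<rfloor> + \<lceil>b\<rceil> + 1) :: real)"
      "of_int (\<lfloor>a\<rfloor> + \<lceil>b\<rceil>) < (of_int (2 * k + 3) :: real)"
      using that k floor_correct[of a] ceiling_correct[of b]
      unfolding of_int_add of_int_mult of_int_numeral of_int_1 by linarith+
    then show ?thesis
      unfolding of_int_less_iff by linarith
  qed
  have "4 * (x - t) + 4 * (x + t) = 8 * x" "4 * (x + t) + 4 * (x - t) = 8 * x"
    by simp_all
  note this[THEN between_sum]
  then have "\<bar>cell (x - t) + cell (x + t) - (4 * k + 2)\<bar> \<le> 2"
    unfolding cell_def by linarith
  then show ?thesis
    using between cell_between k by blast
qed

lemma cell_value_eq_0: "k < -7 \<or> 15 < k \<Longrightarrow> cell_value k = 0"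
  by (simp add: cell_value_def)

lemma cell_value_simps:
  "cell_value (-7) = -8" "cell_value (-6) = 4" "cell_value (-5) = -5" "cell_value (-4) = 4"
  "cell_value (-3) = 8" "cell_value (-2) = 4" "cell_value (-1) = 5" "cell_value 0 = 4"
  "cell_value 1 = 4" "cell_value 2 = 14" "cell_value 3 = 0" "cell_value 4 = 0"
  "cell_value 5 = 0" "cell_value 6 = 0" "cell_value 7 = -4" "cell_value 8 = 0"
  "cell_value 9 = 9" "cell_value 10 = 0" "cell_value 11 = -2" "cell_value 12 = 0"
  "cell_value 13 = -2" "cell_value 14 = 0" "cell_value 15 = -5"
  by (simp_all add: cell_value_def)

text \<open>The library's evaluation rules for \<open>[i..j]\<close> do not cover the bounds \<open>-1\<close>, \<open>0\<close> and \<open>1\<close>.\<close>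

lemmas int_interval_expand =
  set_upto[symmetric] upto_rec1[of "-1"] upto_rec1[of 0] upto_rec1[of 1]

text \<open>With offsets at most 8, a central number outside -15 to 23 puts all three nodes where
  the function vanishes; this fixes the ranges of \<open>k\<close> here and in the next
  check.\<close>

lemma cell_value_grid:
  "\<forall>k\<in>{-7..11}. \<forall>i\<in>{0..8}.
     \<bar>cell_value (2 * k - i) - 2 * cell_value (2 * k) + cell_value (2 * k + i)\<bar> \<le> 24"
  by (simp del: set_upto add: int_interval_expand cell_value_simps cell_value_eq_0)

lemma cell_value_between:
  "\<forall>k\<in>{-8..11}. \<forall>i\<in>{0..8}. \<forall>j\<in>{0..8}. \<bar>i - j\<bar> \<le> 2 \<longrightarrow>
     \<bar>cell_value (2 * k + 1 - i) - 2 * cell_value (2 * k + 1) + cell_value (2 * k + 1 + j)\<bar> \<le> 24"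
  by (simp del: set_upto add: int_interval_expand cell_value_simps cell_value_eq_0)

lemma abs_second_difference_step_example_nonneg:
  assumes "0 \<le> t" "t \<le> 1"
  shows "\<bar>second_difference t step_example x\<bar> \<le> 24"
proof -
  define p q r where "p = cell (x - t)" and "q = cell x" and "r = cell (x + t)"
  have pr: "q - 8 \<le> p" "p \<le> q" "q \<le> r" "r \<le> q + 8"
    using assms cell_le_cell_add_8[of x "x - t"] cell_le_cell_add_8[of "x + t" x]
      mono_cell[of "x - t" x] mono_cell[of x "x + t"]
    by (simp_all add: p_def q_def r_def)
  have "\<bar>cell_value p - 2 * cell_value q + cell_value r\<bar> \<le> 24"
  proof (cases "q \<in> {-15..23}")
    case True
    consider (grid) k where "q = 2 * k" "p + r = 4 * k"
      | (between) k where "q = 2 * k + 1" "\<bar>p + r - (4 * k + 2)\<bar> \<le> 2"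
      using cell_progression[of x t] unfolding p_def q_def r_def by metis
    then show ?thesis
    proof cases
      case grid
      then have "k \<in> {-7..11}" "q - p \<in> {0..8}" "p = 2 * k - (q - p)" "r = 2 * k + (q - p)"
        using True pr by auto
      then show ?thesis
        using cell_value_grid grid(1) by metis
    next
      case between
      then have "k \<in> {-8..11}" "q - p \<in> {0..8}" "r - q \<in> {0..8}" "\<bar>(q - p) - (r - q)\<bar> \<le> 2"
        "p = 2 * k + 1 - (q - p)" "r = 2 * k + 1 + (r - q)"
        using True pr by auto
      then show ?thesis
        using cell_value_between between(1) by metis
    qed
  next
    case False
    then have "cell_value p = 0" "cell_value q = 0" "cell_value r = 0"
      using pr by (auto intro!: cell_value_eq_0)
    then show ?thesis
      by simp
  qed
  then show ?thesis
    unfolding second_difference_def step_example_def p_def q_def r_def by linarith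
qed

lemma abs_second_difference_step_example:
  assumes "\<bar>t\<bar> \<le> 1"
  shows "\<bar>second_difference t step_example x\<bar> \<le> 24"
proof -
  have "second_difference t step_example x = second_difference \<bar>t\<bar> step_example x"
    by (simp add: second_difference_def abs_if)
  then show ?thesis
    using abs_second_difference_step_example_nonneg[of "\<bar>t\<bar>" x] assms by simp
qed

lemma abs_cell_value_le: "\<bar>cell_value k\<bar> \<le> 14"
proof (cases "k \<in> {-7..15}")
  case True
  have "\<forall>k\<in>{-7..15}. \<bar>cell_value k\<bar> \<le> 14"
    by (simp del: set_upto add: int_interval_expand cell_value_simps)
  then show ?thesis
    using True by blast
qed (auto simp: cell_value_eq_0)

lemma locally_integrable_step_example: "locally_integrable step_example"
  unfolding locally_integrable_def set_integrable_def
proof (intro allI impI)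
  fix K :: "real set"
  assume K: "compact K"
  have "step_example \<in> borel_measurable borel"
    unfolding step_example_def cell_def by measurable
  moreover have "K \<in> sets lebesgue"
    using K by (simp add: compact_imp_closed lmeasurable_compact fmeasurableD)
  moreover have "emeasure lebesgue K < \<infinity>"
    using K fmeasurableD2[OF lmeasurable_compact] by (simp add: less_top)
  moreover have "norm (step_example x) \<le> 14" for x
    using abs_cell_value_le[of "cell x"] by (simp add: step_example_def)
  moreover from calculation
  have "(\<lambda>x. indicat_real K x *\<^sub>R step_example x) \<in> borel_measurable lebesgue"
    by (intro borel_measurable_scaleR borel_measurable_indicator measurable_completion) auto
  ultimately show "integrable lebesgue (\<lambda>x. indicat_real K x *\<^sub>R step_example x)"
    by (intro integrableI_bounded_set[where A = K and B = 14])
      (auto simp: indicator_eq_0_iff)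
qed

text \<open>The grid values at the two end points form a null set, so only the odd-indexed value
  counts.\<close>

lemma has_integral_step_example_cell:
  fixes k :: int
  shows "(step_example has_integral cell_value (2 * k + 1) / 4) {k / 4..(k + 1) / 4}"
proof -
  have "((\<lambda>x. of_int (cell_value (2 * k + 1))) has_integral cell_value (2 * k + 1) / 4)
      {k / 4..(k + 1) / 4}"
    using has_integral_const_real[of "of_int (cell_value (2 * k + 1)) :: real" "k / 4" "(k + 1) / 4"]
    by (simp add: diff_divide_distrib[symmetric])
  moreover have "step_example x = cell_value (2 * k + 1)" if "x \<in> {k / 4<..<(k + 1) / 4}" for x
  proof -
    have "cell x = 2 * k + 1"
      using that by (intro cell_between) auto
    then show ?thesis
      by (simp add: step_example_def)
  qed
  ultimately show ?thesis
    using has_integral_spike_interior[of _ _ "k / 4" "(k + 1) / 4" step_example] by simp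
qed

lemma integral_step_example_eq_0:
  fixes j :: int
  shows "(LINT u:{of_int j * 1..(of_int j + 1) * 1}|lebesgue. step_example u) = 0"
proof -
  let ?I = "\<lambda>k. of_int (cell_value (2 * k + 1)) / (4 :: real)"
  note cell = has_integral_step_example_cell
  have "(step_example has_integral ?I (4 * j) + ?I (4 * j + 1) + ?I (4 * j + 2) + ?I (4 * j + 3))
      {of_int (4 * j) / 4..of_int (4 * j + 3 + 1) / 4}"
    using cell[of "4 * j"] cell[of "4 * j + 1"] cell[of "4 * j + 2"] cell[of "4 * j + 3"]
    by (intro has_integral_combine[of "of_int (4 * j) / 4" "of_int (4 * j + 3) / 4"]
        has_integral_combine[of "of_int (4 * j) / 4" "of_int (4 * j + 2) / 4"]
        has_integral_combine[of "of_int (4 * j) / 4" "of_int (4 * j + 1) / 4"])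
      (simp_all add: add.commute)
  moreover have "?I (4 * j) + ?I (4 * j + 1) + ?I (4 * j + 2) + ?I (4 * j + 3) = 0"
  proof -
    \<comment> \<open>The three nontrivial sums are -8 - 5 + 8 + 5, 4 + 0 + 0 - 4 and 9 - 2 - 2 -
      5.\<close>
    consider "j = -1" | "j = 0" | "j = 1" | "j < -1 \<or> 1 < j"
      by linarith
    then show ?thesis
      by cases (auto simp: cell_value_simps cell_value_eq_0)
  qed
  ultimately have "(step_example has_integral 0) {of_int j * 1..(of_int j + 1) * 1}"
    by (simp add: add_divide_distrib add.commute)
  moreover have "set_integrable lebesgue {of_int j * 1..(of_int j + 1) * 1} step_example"
    using locally_integrable_step_example by (simp add: locally_integrable_def)
  ultimately show ?thesis
    using set_lebesgue_integral_eq_integral(2) by (metis integral_unique)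
qed

text \<open>The constant is 14/24, and 7/12 - 1/2 = 3/36 exceeds 3/37.\<close>

lemma is_whitney_constant_ge:
  assumes "is_whitney_constant W"
  shows "7 / 12 \<le> W"
proof -
  have W: "0 < W" "sup_norm step_example \<le> ennreal W * omega2 step_example 1"
    using assms locally_integrable_step_example integral_step_example_eq_0
    unfolding is_whitney_constant_def by (blast intro: zero_less_one)+
  have "ennreal 14 = ennreal \<bar>step_example (1 / 4)\<bar>"
    by (simp add: step_example_def cell_def cell_value_def)
  also have "\<dots> \<le> sup_norm step_example"
    unfolding sup_norm_def by (rule SUP_upper) simp
  also have "\<dots> \<le> ennreal W * omega2 step_example 1"
    by (rule W)
  also have "\<dots> \<le> ennreal W * ennreal 24"
    using abs_second_difference_step_example omega2_le_iff[of 24 step_example 1]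
    by (intro mult_left_mono) auto
  also have "\<dots> = ennreal (W * 24)"
    using W by (simp add: ennreal_mult)
  finally show ?thesis
    using W by (subst (asm) ennreal_le_iff) auto
qed

section \<open>Existence of the smallest constant\<close>

text \<open>For fixed \<open>f\<close> and finite modulus the condition on \<open>W\<close> is
  closed, so it passes to the infimum; the bound 7/12 keeps the infimum positive. Attainment is what
  identifies \<open>LEAST\<close> with the infimum.\<close>

lemma is_whitney_constant_Inf: "is_whitney_constant (Inf (Collect is_whitney_constant))"
  (is "is_whitney_constant ?m")
proof -
  have ne: "Collect is_whitney_constant \<noteq> {}"
    using is_whitney_constant_five_eighths by auto
  have "7 / 12 \<le> ?m"
    using ne is_whitney_constant_ge by (intro cInf_greatest) auto
  then have m: "0 < ?m"
    by linarith
  moreover have "sup_norm f \<le> ennreal ?m * omega2 f h"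
    if "h > 0" "locally_integrable f"
      and zero: "\<forall>j::int. (LINT u:{of_int j * h..(of_int j + 1) * h}|lebesgue. f u) = 0" for f h
  proof (cases "omega2 f h" rule: ennreal_cases)
    case top
    then show ?thesis
      using m by (simp add: ennreal_mult_top)
  next
    case (real w)
    have le: "\<bar>f x\<bar> \<le> W * w" if "is_whitney_constant W" for W x
    proof -
      have "0 < W" "sup_norm f \<le> ennreal W * omega2 f h"
        using that \<open>h > 0\<close> \<open>locally_integrable f\<close> zero by (auto simp: is_whitney_constant_def)
      then show ?thesis
        using whitney_inequality_iff[of W f h w] real by simp
    qed
    have "\<bar>f x\<bar> \<le> ?m * w" for x
    \<comment> \<open>A zero modulus rules out division by \<open>w\<close>, but then the constant
      5/8 already forces \<open>f x = 0\<close>.\<close>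
    proof (cases "w = 0")
      case True
      then show ?thesis
        using le[OF is_whitney_constant_five_eighths, of x] by simp
    next
      case False
      then have "\<bar>f x\<bar> / w \<le> ?m"
        using le real ne by (intro cInf_greatest) (auto simp: divide_le_eq)
      then show ?thesis
        using False real by (simp add: divide_le_eq)
    qed
    then show ?thesis
      using m real whitney_inequality_iff[of ?m f h w] by simp
  qed
  ultimately show ?thesis
    by (simp add: is_whitney_constant_def)
qed

theorem theorem2:
  shows "is_whitney_constant W2_star
    \<and> (\<forall>W. is_whitney_constant W \<longrightarrow> W2_star \<le> W)
    \<and> 1 / 2 + 3 / 37 \<le> W2_star \<and> W2_star \<le> 1 / 2 + 1 / 8"
proof -
  have Inf_le: "Inf (Collect is_whitney_constant) \<le> W" if "is_whitney_constant W" for W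
    using that is_whitney_constant_ge by (intro cInf_lower bdd_belowI[where m = "7 / 12"]) auto
  then have "W2_star = Inf (Collect is_whitney_constant)"
    unfolding W2_star_def by (intro Least_equality is_whitney_constant_Inf)
  then show ?thesis
    using is_whitney_constant_Inf Inf_le is_whitney_constant_ge[OF is_whitney_constant_Inf]
      Inf_le[OF is_whitney_constant_five_eighths] by simp
qed

end
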